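(* Let $(W,S)$ be a Coxeter system, $Q=(\sigma_1,\ldots,\sigma_n)$ a word of size $n$ in $S$, $\pi\in W$, and let $\Delta=\Delta(Q,\pi)$ be the subword complex. Let $k$ be a field and let $G(I_{\Delta^{\vee}})=\{\mathbf{x}_{P_1},\ldots,\mathbf{x}_{P_r}\}\subset k[x_1,\ldots,x_n]$, where $\mathbf{x}_{P_1}>_{lex}\cdots>_{lex}\mathbf{x}_{P_r}$. Then $Q\setminus P_1,\ldots,Q\setminus P_r$ is a shelling order on the facets of $\Delta$.
   Context: A word $Q=(\sigma_1,\ldots,\sigma_n)$ of size $n$ is an ordered sequence of elements of the set $S$ of simple reflections. A subword $P$ of $Q$ is an ordered subsequence, identified with its set of positions in $[n]=\{1,\ldots,n\}$ (so occurrences of the same reflection at different positions are distinguished). $P$ represents $\pi$ if the ordered product of the simple reflections in $P$ is a reduced expression for $\pi$; $P$ contains $\pi$ if some subsequence of $P$ represents $\pi$. The subword complex $\Delta(Q,\pi)$ is the simplicial complex (on the $n$ positions of $Q$) of all subwords $Q\setminus P$ such that $P$ contains $\pi$. For a subword $P=(\sigma_{i_1},\ldots,\sigma_{i_m})$ of $Q$ put $\mathbf{x}_P=x_{i_1}\cdots x_{i_m}$. For a simplicial complex $\Delta$ on $[n]$ with set of facets $\mathcal{F}(\Delta)$, the Stanley--Reisner ideal of the Alexander dual is $I_{\Delta^\vee}=(\mathbf{x}_{[n]\setminus F}\mid F\in\mathcal{F}(\Delta))$; for $\Delta=\Delta(Q,\pi)$ this is $I_{\Delta^\vee}=(\mathbf{x}_P\mid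 P\subseteq Q,\ P\text{ represents }\pi)$. $G(I)$ denotes the minimal monomial generating set of a monomial ideal $I$, and $>_{lex}$ is the lexicographical order with $x_1>\cdots>x_n$. An ordering $F_1,\ldots,F_r$ of the facets of a pure simplicial complex is a shelling order if for all $1\le j<i\le r$ there exist $v\in F_i\setminus F_j$ and $k<i$ with $F_i\setminus F_k=\{v\}$. *)

theory Defs
  imports
    "HOL-Library.Poly_Mapping"
    "HOL-Library.Extended_Nat"
    "HOL-Algebra.Ideal"
    "HOL-Algebra.Generated_Groups"
begin

section \<open>Coxeter systems\<close>

text \<open>
  A group word over \<open>S\<close> is a list of letters \<open>(s, b)\<close>; the letter \<open>(s, True)\<close> stands for \<open>s\<close>
  and \<open>(s, False)\<close> for its formal inverse. Two words are identified in the group presented by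
  \<open>\<langle>S | R\<rangle>\<close> iff they are connected by inserting and deleting cancelling pairs and relators.
\<close>

definition list_product :: "('a, 'b) monoid_scheme \<Rightarrow> 'a list \<Rightarrow> 'a" where
  "list_product W u = foldr (\<otimes>\<^bsub>W\<^esub>) u \<one>\<^bsub>W\<^esub>"

definition word_value :: "('a, 'b) monoid_scheme \<Rightarrow> ('a \<times> bool) list \<Rightarrow> 'a" where
  "word_value W u = list_product W (map (\<lambda>(s, b). if b then s else inv\<^bsub>W\<^esub> s) u)"

inductive presentation_step ::
    "'a set \<Rightarrow> ('a \<times> bool) list set \<Rightarrow> ('a \<times> bool) list \<Rightarrow> ('a \<times> bool) list \<Rightarrow> bool"
  for S R where
  cancel: "\<lbrakk>u \<in> lists (S \<times> UNIV); v \<in> lists (S \<times> UNIV); s \<in> S\<rbrakk>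
    \<Longrightarrow> presentation_step S R (u @ [(s, b), (s, \<not> b)] @ v) (u @ v)"
| relator: "\<lbrakk>u \<in> lists (S \<times> UNIV); v \<in> lists (S \<times> UNIV); r \<in> R\<rbrakk>
    \<Longrightarrow> presentation_step S R (u @ r @ v) (u @ v)"

definition group_presentation ::
    "('a, 'b) monoid_scheme \<Rightarrow> 'a set \<Rightarrow> ('a \<times> bool) list set \<Rightarrow> bool" where
  "group_presentation W S R \<longleftrightarrow>
     group W \<and> S \<subseteq> carrier W \<and> generate W S = carrier W \<and>
     (\<forall>u \<in> lists (S \<times> UNIV). \<forall>v \<in> lists (S \<times> UNIV).
        word_value W u = word_value W v \<longleftrightarrow> equivclp (presentation_step S R) u v)"

definition coxeter_matrix :: "'a set \<Rightarrow> ('a \<Rightarrow> 'a \<Rightarrow> enat) \<Rightarrow> bool" where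
  "coxeter_matrix S m \<longleftrightarrow>
     (\<forall>s \<in> S. \<forall>t \<in> S. m s t \<ge> 1 \<and> m s t = m t s \<and> (m s t = 1 \<longleftrightarrow> s = t))"

text \<open>The relators are the words \<open>(s t)\<^sup>k\<close> with \<open>k = m s t\<close> finite; \<open>s = t\<close> gives \<open>s s\<close>.\<close>

definition coxeter_relators :: "'a set \<Rightarrow> ('a \<Rightarrow> 'a \<Rightarrow> enat) \<Rightarrow> ('a \<times> bool) list set" where
  "coxeter_relators S m =
     {concat (replicate k [(s, True), (t, True)]) | s t k. s \<in> S \<and> t \<in> S \<and> m s t = enat k}"

definition coxeter_system :: "('a, 'b) monoid_scheme \<Rightarrow> 'a set \<Rightarrow> bool" where
  "coxeter_system W S \<longleftrightarrow>
     (\<exists>m. coxeter_matrix S m \<and> group_presentation W S (coxeter_relators S m))"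

definition coxeter_length :: "('a, 'b) monoid_scheme \<Rightarrow> 'a set \<Rightarrow> 'a \<Rightarrow> nat" where
  "coxeter_length W S w = (LEAST l. \<exists>u \<in> lists S. list_product W u = w \<and> length u = l)"

definition reduced_expression :: "('a, 'b) monoid_scheme \<Rightarrow> 'a set \<Rightarrow> 'a list \<Rightarrow> 'a \<Rightarrow> bool" where
  "reduced_expression W S u w \<longleftrightarrow>
     u \<in> lists S \<and> list_product W u = w \<and> length u = coxeter_length W S w"


section \<open>Simplicial complexes and shellings\<close>

definition simplicial_complex :: "'v set \<Rightarrow> 'v set set \<Rightarrow> bool" where
  "simplicial_complex V \<Delta> \<longleftrightarrow> \<Delta> \<subseteq> Pow V \<and> (\<forall>F \<in> \<Delta>. \<forall>F' \<subseteq> F. F' \<in> \<Delta>)"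

definition facets :: "'v set set \<Rightarrow> 'v set set" where
  "facets \<Delta> = {F \<in> \<Delta>. \<forall>F' \<in> \<Delta>. F \<subseteq> F' \<longrightarrow> F' = F}"

definition pure_complex :: "'v set set \<Rightarrow> bool" where
  "pure_complex \<Delta> \<longleftrightarrow> (\<forall>F \<in> facets \<Delta>. \<forall>F' \<in> facets \<Delta>. card F = card F')"

definition shelling_order :: "'v set \<Rightarrow> 'v set set \<Rightarrow> 'v set list \<Rightarrow> bool" where
  "shelling_order V \<Delta> Fs \<longleftrightarrow>
     simplicial_complex V \<Delta> \<and> pure_complex \<Delta> \<and> distinct Fs \<and> set Fs = facets \<Delta> \<and>
     (\<forall>i < length Fs. \<forall>j < i. \<exists>v \<in> Fs ! i - Fs ! j. \<exists>k < i. Fs ! i - Fs ! k = {v})"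


section \<open>Subword complexes\<close>

text \<open>
  A word is a list \<open>Q\<close>, and positions are counted from \<open>0\<close>, so \<open>{..<length Q}\<close> plays the role of
  \<open>[n]\<close> and variables are indexed accordingly. A subword is a set of positions \<open>P\<close>; its sequence
  of letters is \<open>nths Q P\<close>.
\<close>

definition represents ::
    "('a, 'b) monoid_scheme \<Rightarrow> 'a set \<Rightarrow> 'a list \<Rightarrow> nat set \<Rightarrow> 'a \<Rightarrow> bool" where
  "represents W S Q P w \<longleftrightarrow> reduced_expression W S (nths Q P) w"

definition contains_element ::
    "('a, 'b) monoid_scheme \<Rightarrow> 'a set \<Rightarrow> 'a list \<Rightarrow> nat set \<Rightarrow> 'a \<Rightarrow> bool" where
  "contains_element W S Q P w \<longleftrightarrow> (\<exists>P' \<subseteq> P. represents W S Q P' w)"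

definition subword_complex ::
    "('a, 'b) monoid_scheme \<Rightarrow> 'a set \<Rightarrow> 'a list \<Rightarrow> 'a \<Rightarrow> nat set set" where
  "subword_complex W S Q w =
     {{..<length Q} - P | P. P \<subseteq> {..<length Q} \<and> contains_element W S Q P w}"

lemma simplicial_complex_subword_complex:
  "simplicial_complex {..<length Q} (subword_complex W S Q w)"
  unfolding simplicial_complex_def
proof (intro conjI ballI allI impI)
  show "subword_complex W S Q w \<subseteq> Pow {..<length Q}"
    by (auto simp: subword_complex_def)
next
  fix F F' assume "F \<in> subword_complex W S Q w" "F' \<subseteq> F"
  then obtain P where P: "F = {..<length Q} - P" "P \<subseteq> {..<length Q}" "contains_element W S Q P w"
    by (auto simp: subword_complex_def)
  let ?P' = "{..<length Q} - F'"
  have "P \<subseteq> ?P'"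
    using P \<open>F' \<subseteq> F\<close> by auto
  with P have "contains_element W S Q ?P' w"
    unfolding contains_element_def by (meson order_trans)
  moreover have "F' = {..<length Q} - ?P'"
    using P \<open>F' \<subseteq> F\<close> by auto
  ultimately show "F' \<in> subword_complex W S Q w"
    unfolding subword_complex_def by blast
qed


section \<open>Monomial ideals\<close>

text \<open>
  \<open>(nat \<Rightarrow>\<^sub>0 nat) \<Rightarrow>\<^sub>0 'k\<close> is the polynomial ring over \<open>'k\<close> in the variables \<open>x\<^sub>0, x\<^sub>1, \<dots>\<close>;
  \<open>poly_ring n\<close> is its subring \<open>k[x\<^sub>0, \<dots>, x\<^sub>n\<^sub>-\<^sub>1]\<close>.
\<close>

type_synonym 'k mpoly = "(nat \<Rightarrow>\<^sub>0 nat) \<Rightarrow>\<^sub>0 'k"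

definition poly_ring :: "nat \<Rightarrow> ('k::field) mpoly ring" where
  "poly_ring n =
     \<lparr>carrier = {p. \<forall>a \<in> Poly_Mapping.keys p. Poly_Mapping.keys a \<subseteq> {..<n}},
      mult = (*), one = 1, zero = 0, add = (+)\<rparr>"

lemma cring_poly_ring: "cring (poly_ring n :: ('k::field) mpoly ring)"
proof (rule cringI)
  show "abelian_group (poly_ring n :: 'k mpoly ring)"
  proof (rule abelian_groupI, goal_cases)
    case (1 p q)
    then show ?case
      using keys_add[of p q] by (force simp: poly_ring_def)
  next
    case (6 p)
    then show ?case
      by (intro bexI[of _ "- p"]) (auto simp: poly_ring_def)
  qed (auto simp: poly_ring_def algebra_simps)
  show "comm_monoid (poly_ring n :: 'k mpoly ring)"
  proof (rule comm_monoidI, goal_cases)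
    case (1 p q)
    show ?case
      unfolding poly_ring_def
    proof (simp, intro ballI)
      fix c assume "c \<in> Poly_Mapping.keys (p * q)"
      then obtain a b where ab: "c = a + b" "a \<in> Poly_Mapping.keys p" "b \<in> Poly_Mapping.keys q"
        using keys_mult[of p q] by blast
      with 1 have "Poly_Mapping.keys a \<subseteq> {..<n}" "Poly_Mapping.keys b \<subseteq> {..<n}"
        by (auto simp: poly_ring_def)
      then show "Poly_Mapping.keys c \<subseteq> {..<n}"
        using keys_add[of a b] ab by blast
    qed
  qed (auto simp: poly_ring_def algebra_simps)
qed (auto simp: poly_ring_def algebra_simps)

definition monomial :: "(nat \<Rightarrow>\<^sub>0 nat) \<Rightarrow> ('k::field) mpoly" where
  "monomial a = Poly_Mapping.single a 1"

definition monomials :: "nat \<Rightarrow> ('k::field) mpoly set" where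
  "monomials n = {monomial a | a. Poly_Mapping.keys a \<subseteq> {..<n}}"

definition squarefree_monomial :: "nat set \<Rightarrow> ('k::field) mpoly" where
  "squarefree_monomial P = (\<Prod>i\<in>P. monomial (Poly_Mapping.single i 1))"

text \<open>Lexicographic order with \<open>x\<^sub>0 > x\<^sub>1 > \<dots>\<close>.\<close>

definition lex_greater :: "('k::field) mpoly \<Rightarrow> 'k mpoly \<Rightarrow> bool" where
  "lex_greater p q \<longleftrightarrow>
     (\<exists>a b. p = monomial a \<and> q = monomial b \<and>
        (\<exists>i. Poly_Mapping.lookup a i > Poly_Mapping.lookup b i \<and>
           (\<forall>j < i. Poly_Mapping.lookup a j = Poly_Mapping.lookup b j)))"

text \<open>
  For a complex \<open>\<Delta>\<close> on \<open>{..<n}\<close>, the Stanley--Reisner ideal of its Alexander dual.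
\<close>

definition alexander_dual_ideal :: "nat \<Rightarrow> nat set set \<Rightarrow> ('k::field) mpoly set" where
  "alexander_dual_ideal n \<Delta> =
     genideal (poly_ring n) ((\<lambda>F. squarefree_monomial ({..<n} - F)) ` facets \<Delta>)"

text \<open>
  \<open>minimal_monomial_generators n I G\<close> says that \<open>G\<close> is \<open>G(I)\<close>; a monomial ideal has exactly one
  such set.
\<close>

definition minimal_monomial_generators ::
    "nat \<Rightarrow> ('k::field) mpoly set \<Rightarrow> 'k mpoly set \<Rightarrow> bool" where
  "minimal_monomial_generators n I G \<longleftrightarrow>
     G \<subseteq> monomials n \<and> genideal (poly_ring n) G = I \<and>
     (\<forall>G' \<subset> G. genideal (poly_ring n) G' \<noteq> I)"

end

theory Submission
  imports Defs
begin

text \<open>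
  The facets of the subword complex are the complements of the subwords that represent \<open>\<pi>\<close>. These
  all have \<open>\<ell>(\<pi>)\<close> positions, so they form an antichain. Membership of a squarefree monomial in a
  squarefree monomial ideal is divisibility by a generator, hence the minimal monomial generators of
  the dual ideal are exactly the monomials of the representing subwords, with nothing merged and
  nothing lost (\<open>minimal_squarefree_generators\<close>).

  The shelling condition then becomes an exchange statement. Let \<open>P'\<close> be lexicographically greater
  than \<open>P\<close>, and let \<open>v\<close> be the first position where they differ, so \<open>v \<in> P' - P\<close>. The two subwords
  spell \<open>a s b\<close> and \<open>a c\<close>, with the same initial part \<open>a\<close> and with \<open>s\<close> the letter at \<open>v\<close>. Both are
  reduced expressions of \<open>\<pi>\<close>, so \<open>s b\<close> and \<open>c\<close> are reduced expressions of one element, which \<open>s\<close>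
  shortens; by the exchange property \<open>s c'\<close> is again an expression of it, where \<open>c'\<close> is \<open>c\<close> without
  one letter. Say that this letter sits at position \<open>u\<close>. Then \<open>P - {u} \<union> {v}\<close> represents \<open>\<pi>\<close>, and it
  is lexicographically greater than \<open>P\<close> because \<open>v < u\<close>; so its complement comes earlier in the list
  and the complement of \<open>P\<close> exceeds it in the single vertex \<open>v\<close> (\<open>represents_exchange\<close>).

  The exchange property itself has to be derived from the presentation of \<open>W\<close>. A word
  \<open>s\<^sub>1 \<dots> s\<^sub>l\<close> passes through the reflections \<open>s\<^sub>1 \<dots> s\<^sub>i \<dots> s\<^sub>1\<close>, and how often it meets a given reflection
  is, modulo 2, unchanged by inserting or deleting relators. This parity therefore depends only on
  the group element (\<open>odd_reflection_cong\<close>). On the other hand, a word that meets \<open>t\<close> can be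
  multiplied by \<open>t\<close> by deleting a letter (\<open>odd_reflection_deletion\<close>). A reduced word \<open>s b\<close> meets the
  reflection \<open>s\<close> an odd number of times, hence so does \<open>c\<close>, and deletion gives the exchange.
\<close>

section \<open>Parity of the reflections met by a word\<close>

lemma list_product_Nil [simp]: "list_product W [] = \<one>\<^bsub>W\<^esub>"
  and list_product_Cons [simp]: "list_product W (s # u) = s \<otimes>\<^bsub>W\<^esub> list_product W u"
  by (simp_all add: list_product_def)

lemma (in group) list_product_closed [simp]:
  "u \<in> lists (carrier G) \<Longrightarrow> list_product G u \<in> carrier G"
  by (induction u) auto

lemma (in group) list_product_append:
  "u \<in> lists (carrier G) \<Longrightarrow> v \<in> lists (carrier G) \<Longrightarrow>
    list_product G (u @ v) = list_product G u \<otimes> list_product G v"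
  by (induction u) (auto simp: m_assoc)

text \<open>
  For a word of involutions \<open>s\<^sub>1 \<dots> s\<^sub>l\<close>, this is the parity of the number of indices \<open>i\<close> with
  \<open>s\<^sub>1 \<dots> s\<^sub>i \<dots> s\<^sub>1 = t\<close>. It is the second component of the usual action of words on
  pairs of a reflection and a sign; carrying the parity alone avoids both the sign and the
  set of reflections. Instead of conjugating the rest of the list by \<open>s\<close>, the recursion conjugates
  the element that is searched for.
\<close>

primrec odd_reflection :: "('a, 'b) monoid_scheme \<Rightarrow> 'a list \<Rightarrow> 'a \<Rightarrow> bool" where
  "odd_reflection W [] t = False"
| "odd_reflection W (s # u) t =
     ((t = s) \<noteq> odd_reflection W u (inv\<^bsub>W\<^esub> s \<otimes>\<^bsub>W\<^esub> t \<otimes>\<^bsub>W\<^esub> s))"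

lemma (in group) odd_reflection_append:
  assumes "u \<in> lists (carrier G)" "v \<in> lists (carrier G)" "t \<in> carrier G"
  shows "odd_reflection G (u @ v) t \<longleftrightarrow>
    (odd_reflection G u t \<noteq>
     odd_reflection G v (inv (list_product G u) \<otimes> t \<otimes> list_product G u))"
  using assms
proof (induction u arbitrary: t)
  case (Cons s u)
  then have *: "s \<in> carrier G" "list_product G u \<in> carrier G" "t \<in> carrier G"
    by auto
  then have "inv (list_product G u) \<otimes> (inv s \<otimes> t \<otimes> s) \<otimes> list_product G u =
      inv (list_product G (s # u)) \<otimes> t \<otimes> list_product G (s # u)"
    by (simp add: inv_mult_group m_assoc)
  with Cons * show ?case by auto
qed auto

text \<open>
  If \<open>t = s\<^sub>1 \<dots> s\<^sub>i \<dots> s\<^sub>1\<close>, then the factor \<open>s\<^sub>1 \<dots> s\<^sub>i\<close> on the right of \<open>t\<close> cancels against the start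
  of the word, and what is left is the word without its \<open>i\<close>-th letter. An odd count is used only to
  know that such an \<open>i\<close> exists.
\<close>

lemma (in group) odd_reflection_deletion:
  assumes "u \<in> lists (carrier G)" "t \<in> carrier G" "\<forall>s \<in> set u. s \<otimes> s = \<one>"
    and "odd_reflection G u t"
  shows "\<exists>i < length u. t \<otimes> list_product G u = list_product G (take i u @ drop (Suc i) u)"
  using assms
proof (induction u arbitrary: t)
  case (Cons s u)
  then have s: "s \<in> carrier G" "s \<otimes> s = \<one>" and u: "list_product G u \<in> carrier G"
    by auto
  show ?case
  proof (cases "t = s")
    case True
    then have "t \<otimes> list_product G (s # u) = list_product G u"
      using s u by (simp flip: m_assoc)
    then show ?thesis by (intro exI[of _ 0]) auto
  next
    case False
    then have "odd_reflection G u (inv s \<otimes> t \<otimes> s)"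
      using Cons.prems by auto
    then obtain i where i: "i < length u" "inv s \<otimes> t \<otimes> s \<otimes> list_product G u =
        list_product G (take i u @ drop (Suc i) u)"
      using Cons.IH[of "inv s \<otimes> t \<otimes> s"] Cons.prems s by auto
    have "s \<otimes> (inv s \<otimes> x) = x" if "x \<in> carrier G" for x
      using s that by (simp flip: m_assoc)
    then have "t \<otimes> list_product G (s # u) = s \<otimes> (inv s \<otimes> t \<otimes> s \<otimes> list_product G u)"
      using s u Cons.prems by (simp add: m_assoc)
    then have "t \<otimes> list_product G (s # u) =
        list_product G (take (Suc i) (s # u) @ drop (Suc (Suc i)) (s # u))"
      using i by simp
    then show ?thesis using i by (intro exI[of _ "Suc i"]) auto
  qed
qed auto

lemma (in group) list_product_replicate:
  assumes "s \<in> carrier G" "t \<in> carrier G"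
  shows "list_product G (concat (replicate k [s, t])) = (s \<otimes> t) [^] k"
proof (induction k)
  case (Suc k)
  have "(s \<otimes> t) [^] Suc k = s \<otimes> t \<otimes> (s \<otimes> t) [^] k"
    using assms by (intro nat_pow_Suc2) simp
  with Suc show ?case using assms by (simp add: m_assoc del: nat_pow_Suc)
qed simp

text \<open>
  The involution \<open>s\<close> inverts the rotation \<open>s t\<close> of the dihedral group that \<open>s\<close> and \<open>t\<close> generate.
\<close>

lemma (in group) dihedral_power_conj:
  assumes "s \<in> carrier G" "t \<in> carrier G" "s \<otimes> s = \<one>" "t \<otimes> t = \<one>"
  shows "(s \<otimes> t) [^] (k::nat) \<otimes> s \<otimes> (s \<otimes> t) [^] k = s"
proof (induction k)
  case (Suc k)
  have "s \<otimes> t \<otimes> s \<otimes> (s \<otimes> t) = s \<otimes> (t \<otimes> (s \<otimes> s) \<otimes> t)"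
    using assms(1,2) by (simp add: m_assoc)
  then have wsw: "s \<otimes> t \<otimes> s \<otimes> (s \<otimes> t) = s"
    using assms by simp
  have "(s \<otimes> t) [^] Suc k \<otimes> s \<otimes> (s \<otimes> t) [^] Suc k =
      (s \<otimes> t) [^] k \<otimes> (s \<otimes> t \<otimes> s \<otimes> (s \<otimes> t)) \<otimes> (s \<otimes> t) [^] k"
    using assms(1,2) by (subst (2) nat_pow_Suc2) (simp_all add: m_assoc)
  then show ?case using wsw Suc by simp
qed (use assms in simp)

text \<open>
  The \<open>i\<close>-th reflection met by the alternating word \<open>s t s t \<dots>\<close> is \<open>(s t)\<^sup>i s\<close>, counting from
  \<open>i = 0\<close>; a block \<open>[s, t]\<close> contributes two of them.
\<close>

lemma (in group) odd_reflection_replicate: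
  assumes st: "s \<in> carrier G" "t \<in> carrier G" "s \<otimes> s = \<one>" "t \<otimes> t = \<one>"
    and r: "r \<in> carrier G"
  shows "odd_reflection G (concat (replicate k [s, t])) r \<longleftrightarrow>
    odd (\<Sum>i<2 * k. of_bool (r = (s \<otimes> t) [^] i \<otimes> s) :: nat)"
proof (induction k)
  case (Suc k)
  define w where "w = s \<otimes> t"
  have w: "w \<in> carrier G" using st by (simp add: w_def)
  \<comment> \<open>Conjugating back past the first \<open>k\<close> blocks doubles the exponent, as \<open>s\<close> inverts \<open>w\<close>.\<close>
  have shift: "inv (w [^] k) \<otimes> r \<otimes> w [^] k = w [^] j \<otimes> s \<longleftrightarrow>
      r = w [^] (2 * k + j) \<otimes> s" for j :: nat
  proof -
    have "w [^] (2 * k + j) = w [^] k \<otimes> w [^] j \<otimes> w [^] k"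
      using w by (simp add: nat_pow_mult mult_2 add_ac)
    then have "w [^] (2 * k + j) \<otimes> s \<otimes> w [^] k =
        w [^] k \<otimes> w [^] j \<otimes> (w [^] k \<otimes> s \<otimes> w [^] k)"
      using w st by (simp add: m_assoc)
    also have "\<dots> = w [^] k \<otimes> (w [^] j \<otimes> s)"
      using dihedral_power_conj[OF st] w st by (simp add: w_def m_assoc)
    finally have "r = w [^] (2 * k + j) \<otimes> s \<longleftrightarrow> r \<otimes> w [^] k = w [^] k \<otimes> (w [^] j \<otimes> s)"
      using w st r by (metis m_closed nat_pow_closed right_cancel)
    also have "\<dots> \<longleftrightarrow> inv (w [^] k) \<otimes> r \<otimes> w [^] k = w [^] j \<otimes> s"
      using w st r inv_solve_left'[of "w [^] j \<otimes> s" "w [^] k" "r \<otimes> w [^] k"]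
      by (auto simp: m_assoc)
    finally show ?thesis by simp
  qed
  have "concat (replicate (Suc k) [s, t]) = concat (replicate k [s, t]) @ [s, t]"
    by (induction k) auto
  moreover have "concat (replicate k [s, t]) \<in> lists (carrier G)"
    using st by (induction k) auto
  ultimately have "odd_reflection G (concat (replicate (Suc k) [s, t])) r \<longleftrightarrow>
      (odd_reflection G (concat (replicate k [s, t])) r \<noteq>
       odd_reflection G [s, t] (inv (w [^] k) \<otimes> r \<otimes> w [^] k))"
    using st r by (simp only: odd_reflection_append list_product_replicate lists.intros w_def)
  moreover have "inv s \<otimes> x \<otimes> s = t \<longleftrightarrow> x = w [^] Suc 0 \<otimes> s" if "x \<in> carrier G" for x
  proof -
    have "inv s = s" using st by (simp add: inv_equality)
    moreover have ss: "s \<otimes> (s \<otimes> y) = y" if "y \<in> carrier G" for y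
      using st that by (simp flip: m_assoc)
    then have "s \<otimes> x \<otimes> s = t \<longleftrightarrow> x = s \<otimes> t \<otimes> s"
      using st that by (auto simp: m_assoc)
    ultimately show ?thesis using st by (simp add: w_def)
  qed
  then have "odd_reflection G [s, t] (inv (w [^] k) \<otimes> r \<otimes> w [^] k) \<longleftrightarrow>
      ((r = w [^] (2 * k) \<otimes> s) \<noteq> (r = w [^] Suc (2 * k) \<otimes> s))"
    using shift[of 0] shift[of 1] w st r by simp
  moreover have "odd (\<Sum>i<2 * Suc k. of_bool (r = w [^] i \<otimes> s) :: nat) \<longleftrightarrow>
      (odd (\<Sum>i<2 * k. of_bool (r = w [^] i \<otimes> s) :: nat) \<noteq>
       ((r = w [^] (2 * k) \<otimes> s) \<noteq> (r = w [^] Suc (2 * k) \<otimes> s)))"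
  proof -
    have "2 * Suc k = Suc (Suc (2 * k))" by simp
    then show ?thesis
      by (simp only: sum.lessThan_Suc even_add) (auto simp del: nat_pow_Suc)
  qed
  ultimately show ?case
    using Suc.IH unfolding w_def[symmetric] by argo
qed simp

text \<open>
  When \<open>(s t)\<^sup>k = 1\<close>, the reflections \<open>(s t)\<^sup>i s\<close> repeat with period \<open>k\<close>, so in a word of \<open>2 k\<close> letters
  each of them is met an even number of times.
\<close>

lemma (in group) odd_reflection_relator:
  assumes st: "s \<in> carrier G" "t \<in> carrier G" "s \<otimes> s = \<one>" "t \<otimes> t = \<one>"
    and r: "r \<in> carrier G" and k: "(s \<otimes> t) [^] k = \<one>"
  shows "\<not> odd_reflection G (concat (replicate k [s, t])) r"
proof -
  have split: "(\<Sum>i<m + n. f i) = (\<Sum>i<m. f i) + (\<Sum>i<n. f (m + i))" for f :: "nat \<Rightarrow> nat" and m n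
    by (induction n) auto
  have "(s \<otimes> t) [^] (k + i) = (s \<otimes> t) [^] i" for i
    using st k by (simp flip: nat_pow_mult)
  then show ?thesis
    by (simp add: odd_reflection_replicate[OF st r] mult_2 split)
qed

lemma coxeter_system_group:
  assumes "coxeter_system W S"
  shows "group W" "S \<subseteq> carrier W"
  using assms by (auto simp: coxeter_system_def group_presentation_def)

lemma coxeter_relator_value:
  assumes "group_presentation W S (coxeter_relators S m)" "s \<in> S" "t \<in> S" "m s t = enat k"
  shows "(s \<otimes>\<^bsub>W\<^esub> t) [^]\<^bsub>W\<^esub> k = \<one>\<^bsub>W\<^esub>"
proof -
  interpret group W using assms(1) by (simp add: group_presentation_def)
  have S: "S \<subseteq> carrier W" using assms(1) by (simp add: group_presentation_def)
  let ?r = "concat (replicate k [(s, True), (t, True)])"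
  have r: "?r \<in> lists (S \<times> UNIV)" using assms(2,3) by (induction k) auto
  have "presentation_step S (coxeter_relators S m) ([] @ ?r @ []) ([] @ [])"
    by (rule presentation_step.relator) (use assms in \<open>auto simp: coxeter_relators_def\<close>)
  then have "equivclp (presentation_step S (coxeter_relators S m)) ?r []"
    by (simp add: r_into_equivclp)
  then have "word_value W ?r = word_value W []"
    using assms(1) r unfolding group_presentation_def by blast
  moreover have "map (\<lambda>(s, b). if b then s else inv\<^bsub>W\<^esub> s) ?r = concat (replicate k [s, t])"
    by (induction k) auto
  ultimately show ?thesis
    using assms(2,3) S by (simp add: word_value_def list_product_replicate subset_iff)
qed

lemma coxeter_involution:
  assumes "coxeter_system W S" "s \<in> S"
  shows "s \<otimes>\<^bsub>W\<^esub> s = \<one>\<^bsub>W\<^esub>"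
proof -
  interpret group W using assms coxeter_system_group by blast
  obtain m where "coxeter_matrix S m" "group_presentation W S (coxeter_relators S m)"
    using assms(1) by (auto simp: coxeter_system_def)
  moreover from this have "m s s = enat 1"
    using assms(2) by (simp add: coxeter_matrix_def one_enat_def)
  ultimately have "(s \<otimes>\<^bsub>W\<^esub> s) [^]\<^bsub>W\<^esub> (1::nat) = \<one>\<^bsub>W\<^esub>"
    using assms(2) coxeter_relator_value[of W S m s s 1] by blast
  then show ?thesis
    using assms coxeter_system_group(2)[OF assms(1)] by (simp add: subset_iff)
qed

text \<open>
  Formal inverses may be forgotten because the generators are involutions. A cancelling pair then
  reads \<open>s s\<close>, which is the relator of \<open>(s, s)\<close> with exponent 1, so both kinds of steps are covered by
  the count for relators.
\<close>

lemma presentation_step_odd_reflection: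
  assumes "coxeter_system W S" "group_presentation W S (coxeter_relators S m)"
    and "presentation_step S (coxeter_relators S m) x y" "t \<in> carrier W"
  shows "odd_reflection W (map fst x) t = odd_reflection W (map fst y) t"
proof -
  interpret group W using assms coxeter_system_group by blast
  note S = coxeter_system_group(2)[OF assms(1)]
  have in_carrier: "map fst u \<in> lists (carrier W)" if "u \<in> lists (S \<times> UNIV)" for u :: "('a \<times> bool) list"
    using that S by (induction u) auto
  \<comment> \<open>The factor must have value 1, or the reflections met after it would be conjugated.\<close>
  have drop: "odd_reflection W (a @ z @ b) t = odd_reflection W (a @ b) t"
    if "a \<in> lists (carrier W)" "b \<in> lists (carrier W)" "z \<in> lists (carrier W)"
      "list_product W z = \<one>\<^bsub>W\<^esub>" "\<And>r. r \<in> carrier W \<Longrightarrow> \<not> odd_reflection W z r" for a b z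
    using that assms(4) by (simp add: odd_reflection_append list_product_append)
  from assms(3) show ?thesis
  proof cases
    case (cancel u v s b)
    have s: "s \<in> carrier W" "s \<otimes>\<^bsub>W\<^esub> s = \<one>\<^bsub>W\<^esub>"
      using cancel S coxeter_involution[OF assms(1)] by auto
    have nodd: "\<not> odd_reflection W [s, s] r" if "r \<in> carrier W" for r
      using odd_reflection_relator[of s s r 1] s that by simp
    then have "odd_reflection W (map fst u @ [s, s] @ map fst v) t = odd_reflection W (map fst u @ map fst v) t"
      using s in_carrier cancel nodd by (intro drop) (auto simp del: odd_reflection.simps)
    then show ?thesis using cancel by simp
  next
    case (relator u v r)
    then obtain s s' k where r: "r = concat (replicate k [(s, True), (s', True)])"
      "s \<in> S" "s' \<in> S" "m s s' = enat k"
      by (auto simp: coxeter_relators_def)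
    have fst_r: "map fst r = concat (replicate k [s, s'])"
      unfolding r by (induction k) auto
    have k: "(s \<otimes>\<^bsub>W\<^esub> s') [^]\<^bsub>W\<^esub> k = \<one>\<^bsub>W\<^esub>"
      using coxeter_relator_value[OF assms(2)] r by blast
    have inv: "s \<in> carrier W" "s' \<in> carrier W" "s \<otimes>\<^bsub>W\<^esub> s = \<one>\<^bsub>W\<^esub>" "s' \<otimes>\<^bsub>W\<^esub> s' = \<one>\<^bsub>W\<^esub>"
      using r S coxeter_involution[OF assms(1)] by auto
    have "concat (replicate k [s, s']) \<in> lists (carrier W)"
      using inv by (induction k) auto
    then have "odd_reflection W (map fst u @ map fst r @ map fst v) t =
        odd_reflection W (map fst u @ map fst v) t"
      using in_carrier relator odd_reflection_relator[OF inv] k inv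
      by (intro drop) (auto simp: fst_r list_product_replicate)
    then show ?thesis using relator by simp
  qed
qed

text \<open>
  Words with the same value are linked by presentation steps, each of which keeps the parity.
\<close>

lemma odd_reflection_cong:
  assumes "coxeter_system W S" "u \<in> lists S" "v \<in> lists S"
    and "list_product W u = list_product W v" "t \<in> carrier W"
  shows "odd_reflection W u t = odd_reflection W v t"
proof -
  obtain m where m: "group_presentation W S (coxeter_relators S m)"
    using assms(1) by (auto simp: coxeter_system_def)
  let ?p = "map (\<lambda>s. (s, True))"
  have "equivclp (presentation_step S (coxeter_relators S m)) (?p u) (?p v)"
  proof -
    have "word_value W (?p u) = word_value W (?p v)"
      using assms(4) by (simp add: word_value_def comp_def)
    moreover have "?p u \<in> lists (S \<times> UNIV)" "?p v \<in> lists (S \<times> UNIV)"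
      using assms(2,3) by auto
    ultimately show ?thesis using m unfolding group_presentation_def by blast
  qed
  then have "odd_reflection W (map fst (?p u)) t = odd_reflection W (map fst (?p v)) t"
  proof (induction rule: equivclp_induct)
    case (step y z)
    then show ?case
      using presentation_step_odd_reflection[OF assms(1) m _ assms(5)] by metis
  qed simp
  then show ?thesis by (simp add: comp_def)
qed

section \<open>The exchange property\<close>

lemma reduced_expression_minimal:
  assumes "reduced_expression W S u w" "v \<in> lists S" "list_product W v = w"
  shows "length u \<le> length v"
  using assms unfolding reduced_expression_def coxeter_length_def
  by (metis (mono_tags, lifting) Least_le)

text \<open>
  After cancelling \<open>a\<close>, the words \<open>c\<close> and \<open>s b\<close> have the same value, so \<open>c\<close> inherits from the reduced
  word \<open>s b\<close> that it meets the reflection \<open>s\<close> an odd number of times. The common prefix \<open>a\<close> is kept so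
  that the lemma applies to subwords directly, without a passage to reduced suffixes.
\<close>

lemma coxeter_exchange:
  assumes W: "coxeter_system W S" and red: "reduced_expression W S (a @ s # b) w"
    and c: "c \<in> lists S" "list_product W (a @ c) = w"
  shows "\<exists>i < length c. list_product W (a @ s # take i c @ drop (Suc i) c) = w"
proof -
  interpret group W using W coxeter_system_group by blast
  note S = coxeter_system_group(2)[OF W]
  have in_S: "a \<in> lists S" "s \<in> S" "b \<in> lists S"
    using red by (auto simp: reduced_expression_def)
  have carr: "u \<in> lists (carrier W)" if "u \<in> lists S" for u
    using that S by auto
  have s: "s \<in> carrier W" "s \<otimes>\<^bsub>W\<^esub> s = \<one>\<^bsub>W\<^esub>" "inv\<^bsub>W\<^esub> s = s"
    using in_S S coxeter_involution[OF W] by (auto simp: inv_equality)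
  have invol: "\<forall>s \<in> set u. s \<otimes>\<^bsub>W\<^esub> s = \<one>\<^bsub>W\<^esub>" if "u \<in> lists S" for u
    using that coxeter_involution[OF W] by auto
  have sub: "take i u @ drop (Suc i) u \<in> lists S" if "u \<in> lists S" for i u
    using that by (auto dest: in_set_takeD in_set_dropD)
  have "list_product W a \<otimes>\<^bsub>W\<^esub> list_product W (s # b) = list_product W a \<otimes>\<^bsub>W\<^esub> list_product W c"
    using red c in_S s carr by (simp add: reduced_expression_def list_product_append)
  then have eq: "list_product W (s # b) = list_product W c"
    using in_S c s carr by simp
  \<comment> \<open>Otherwise deleting a letter of \<open>b\<close> absorbs \<open>s\<close>, and \<open>a s b\<close> loses two letters.\<close>
  have "\<not> odd_reflection W b s"
  proof
    assume "odd_reflection W b s"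
    then obtain i where i: "i < length b"
      "s \<otimes>\<^bsub>W\<^esub> list_product W b = list_product W (take i b @ drop (Suc i) b)"
      using odd_reflection_deletion[of b s] in_S s carr invol by blast
    then have "list_product W (a @ take i b @ drop (Suc i) b) = w"
      using red in_S s carr sub[of b]
      by (simp add: reduced_expression_def list_product_append del: append_assoc)
    then have "length (a @ s # b) \<le> length (a @ take i b @ drop (Suc i) b)"
      using in_S sub[of b i] by (intro reduced_expression_minimal[OF red]) simp_all
    then show False using i by simp
  qed
  then have "odd_reflection W (s # b) s"
    using s by simp
  moreover have "s # b \<in> lists S" using in_S by simp
  ultimately have "odd_reflection W c s"
    using odd_reflection_cong[OF W _ c(1) eq s(1)] by blast
  then obtain i where i: "i < length c"
    "s \<otimes>\<^bsub>W\<^esub> list_product W c = list_product W (take i c @ drop (Suc i) c)"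
    using odd_reflection_deletion[of c s] c s carr invol by blast
  have "list_product W (s # take i c @ drop (Suc i) c) = list_product W c"
    unfolding list_product_Cons i(2)[symmetric] using s c carr by (simp flip: m_assoc)
  moreover have "s # take i c @ drop (Suc i) c \<in> lists (carrier W)"
    using s carr[OF sub[OF c(1), of i]] by simp
  ultimately have "list_product W (a @ s # take i c @ drop (Suc i) c) = w"
    using c in_S carr by (simp only: list_product_append)
  then show ?thesis using i by blast
qed

section \<open>Exchanging positions of a subword\<close>

text \<open>
  The exchange property deletes a letter of the spelled word; a shelling needs the position in \<open>Q\<close>
  that this letter comes from.
\<close>

lemma nths_remove_position:
  assumes "i < length (nths Q P)"
  shows "\<exists>u \<in> P. u < length Q \<and>
    nths Q (P - {u}) = take i (nths Q P) @ drop (Suc i) (nths Q P)"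
  using assms
proof (induction Q arbitrary: P i)
  case (Cons q Q)
  have shift: "{j. Suc j \<in> P \<and> j \<noteq> u} = {j. Suc j \<in> P} - {u}" for u
    by auto
  show ?case
  proof (cases "0 \<in> P \<and> i = 0")
    case True
    then show ?thesis by (intro bexI[of _ 0]) (auto simp: nths_Cons)
  next
    case False
    define i' where "i' = (if 0 \<in> P then i - 1 else i)"
    have "i' < length (nths Q {j. Suc j \<in> P})"
      using Cons.prems False by (auto simp: nths_Cons i'_def split: if_splits)
    then obtain u where "Suc u \<in> P" "u < length Q"
      "nths Q ({j. Suc j \<in> P} - {u}) =
         take i' (nths Q {j. Suc j \<in> P}) @ drop (Suc i') (nths Q {j. Suc j \<in> P})"
      using Cons.IH[of i' "{j. Suc j \<in> P}"] by auto
    then show ?thesis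
      using False
      by (intro bexI[of _ "Suc u"]) (auto simp: nths_Cons shift i'_def take_Cons drop_Cons split: nat.splits)
  qed
qed simp

lemma nths_split_at:
  assumes "v < length Q"
  shows "nths Q P = nths (take v Q) P @ (if v \<in> P then [Q ! v] else []) @
    nths (drop (Suc v) Q) {j. Suc v + j \<in> P}"
proof -
  have "nths Q P = nths (take v Q @ Q ! v # drop (Suc v) Q) P"
    using assms by (simp add: id_take_nth_drop[symmetric])
  also have "\<dots> = nths (take v Q) P @ nths (Q ! v # drop (Suc v) Q) {j. v + j \<in> P}"
    using assms by (simp add: nths_append add.commute min_def)
  finally show ?thesis by (simp add: nths_Cons)
qed

lemma nths_take_cong:
  assumes "\<And>j. j < v \<Longrightarrow> j \<in> P \<longleftrightarrow> j \<in> P'"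
  shows "nths (take v Q) P = nths (take v Q) P'"
proof -
  have "nths (take v Q) P = nths (take v Q) (P \<inter> {..<v})" for P
    unfolding nths_def
    by (intro arg_cong[of _ _ "map fst"] filter_cong) (auto simp: set_zip)
  moreover have "P \<inter> {..<v} = P' \<inter> {..<v}" using assms by auto
  ultimately show ?thesis by metis
qed

text \<open>
  The deleted letter comes from the part of \<open>P\<close> after \<open>v\<close>, since the parts before \<open>v\<close> agree and are
  carried along as the prefix in the exchange property. This gives \<open>v < u\<close>, and so the new
  subword is lexicographically greater than \<open>P\<close>.
\<close>

lemma represents_exchange:
  assumes W: "coxeter_system W S" and Q: "Q \<in> lists S"
    and P: "represents W S Q P w" and P': "represents W S Q P' w"
    and v: "v \<in> P'" "v \<notin> P" "v < length Q" and agree: "\<And>j. j < v \<Longrightarrow> j \<in> P \<longleftrightarrow> j \<in> P'"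
  shows "\<exists>u \<in> P. v < u \<and> u < length Q \<and> represents W S Q (insert v P - {u}) w"
proof -
  define a where "a = nths (take v Q) P"
  define P1 where "P1 = {j. Suc v + j \<in> P}"
  define c where "c = nths (drop (Suc v) Q) P1"
  define b where "b = nths (drop (Suc v) Q) {j. Suc v + j \<in> P'}"
  have P_split: "nths Q P = a @ c"
    using v by (simp add: nths_split_at[of v Q P] a_def c_def P1_def)
  have P'_split: "nths Q P' = a @ Q ! v # b"
    using v nths_take_cong[of v P P' Q] agree by (simp add: nths_split_at[of v Q P'] a_def b_def)
  have red: "reduced_expression W S (a @ c) w" "reduced_expression W S (a @ Q ! v # b) w"
    using P P' by (simp_all add: represents_def P_split P'_split)
  then have "c \<in> lists S" "list_product W (a @ c) = w"
    by (auto simp: reduced_expression_def)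
  then obtain i where i: "i < length c"
    "list_product W (a @ Q ! v # take i c @ drop (Suc i) c) = w"
    using coxeter_exchange[OF W red(2)] by blast
  obtain u where u: "u \<in> P1" "u < length (drop (Suc v) Q)"
    "nths (drop (Suc v) Q) (P1 - {u}) = take i c @ drop (Suc i) c"
    using nths_remove_position[of i "drop (Suc v) Q" P1] i(1) unfolding c_def by blast
  define u' where "u' = Suc v + u"
  have before: "nths (take v Q) (insert v P - {u'}) = a"
    unfolding a_def by (rule nths_take_cong) (auto simp: u'_def)
  have after: "{j. Suc v + j \<in> insert v P - {u'}} = P1 - {u}"
    by (auto simp: P1_def u'_def)
  have "nths Q (insert v P - {u'}) = a @ Q ! v # take i c @ drop (Suc i) c"
    unfolding nths_split_at[OF v(3), of "insert v P - {u'}"] before after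
    using u by (simp add: u'_def)
  moreover have "a @ Q ! v # take i c @ drop (Suc i) c \<in> lists S"
    using red by (auto simp: reduced_expression_def dest: in_set_takeD in_set_dropD)
  ultimately have "represents W S Q (insert v P - {u'}) w"
    using i red(1) by (auto simp: represents_def reduced_expression_def)
  moreover have "u' \<in> P" "v < u'" "u' < length Q"
    using u by (auto simp: u'_def P1_def)
  ultimately show ?thesis by blast
qed

section \<open>Facets of the subword complex\<close>

lemma card_represents:
  assumes "represents W S Q P w" "P \<subseteq> {..<length Q}"
  shows "card P = coxeter_length W S w"
proof -
  have "{i. i < length Q \<and> i \<in> P} = P" using assms(2) by auto
  then show ?thesis
    using assms(1) by (simp add: represents_def reduced_expression_def length_nths)
qed

lemma represents_subset_eq:
  assumes "represents W S Q P w" "P \<subseteq> {..<length Q}" "represents W S Q P' w" "P' \<subseteq> P"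
  shows "P' = P"
proof (rule card_subset_eq)
  show "finite P" using assms(2) finite_subset by blast
  show "card P' = card P" using assms card_represents[of W S Q _ w] by (metis order_trans)
qed (rule assms)

lemma facets_subword_complex:
  "facets (subword_complex W S Q w) =
    (\<lambda>P. {..<length Q} - P) ` {P. P \<subseteq> {..<length Q} \<and> represents W S Q P w}"
  (is "?L = ?C ` ?R")
proof (intro equalityI subsetI)
  fix F assume F: "F \<in> ?L"
  then obtain P P' where P: "F = ?C P" "P \<subseteq> {..<length Q}" "P' \<subseteq> P" "represents W S Q P' w"
    by (auto simp: facets_def subword_complex_def contains_element_def)
  then have "?C P' \<in> subword_complex W S Q w" "F \<subseteq> ?C P'"
    by (auto simp: subword_complex_def contains_element_def)
  then have "?C P' = F" using F by (auto simp: facets_def)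
  then show "F \<in> ?C ` ?R" using P by blast
next
  fix F assume "F \<in> ?C ` ?R"
  then obtain P where P: "F = ?C P" "P \<subseteq> {..<length Q}" "represents W S Q P w" by auto
  show "F \<in> ?L"
    unfolding facets_def
  proof (intro CollectI conjI ballI impI)
    show "F \<in> subword_complex W S Q w"
      using P by (auto simp: subword_complex_def contains_element_def)
    fix F' assume "F' \<in> subword_complex W S Q w" "F \<subseteq> F'"
    then obtain P1 P2 where P1: "F' = ?C P1" "P1 \<subseteq> {..<length Q}" "P2 \<subseteq> P1"
      "represents W S Q P2 w"
      by (auto simp: subword_complex_def contains_element_def)
    have "P1 \<subseteq> P" using \<open>F \<subseteq> F'\<close> P P1 by auto
    moreover have "P2 = P"
      using represents_subset_eq[OF P(3,2) P1(4)] P1 \<open>P1 \<subseteq> P\<close> by auto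
    ultimately show "F' = F" using P P1 by auto
  qed
qed

section \<open>Squarefree monomial ideals\<close>

lemma monomial_eq_iff: "(monomial a :: ('k::field) mpoly) = monomial b \<longleftrightarrow> a = b"
proof
  assume "(monomial a :: 'k mpoly) = monomial b"
  then have "Poly_Mapping.keys (monomial a :: 'k mpoly) = Poly_Mapping.keys (monomial b :: 'k mpoly)"
    by simp
  then show "a = b" by (simp add: monomial_def)
qed simp

definition indicator_exponent :: "nat set \<Rightarrow> (nat \<Rightarrow>\<^sub>0 nat)" where
  "indicator_exponent P = (\<Sum>i\<in>P. Poly_Mapping.single i 1)"

lemma lookup_indicator_exponent:
  "finite P \<Longrightarrow> Poly_Mapping.lookup (indicator_exponent P) i = of_bool (i \<in> P)"
  by (simp add: indicator_exponent_def lookup_sum lookup_single when_def)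

lemma keys_indicator_exponent:
  "finite P \<Longrightarrow> Poly_Mapping.keys (indicator_exponent P) = P"
  by (auto simp: in_keys_iff lookup_indicator_exponent)

lemma squarefree_monomial_eq:
  "finite P \<Longrightarrow> (squarefree_monomial P :: ('k::field) mpoly) = monomial (indicator_exponent P)"
  by (induction P rule: finite_induct)
    (auto simp: squarefree_monomial_def indicator_exponent_def monomial_def mult_single)

lemma squarefree_monomial_closed:
  assumes "P \<subseteq> {..<n}"
  shows "(squarefree_monomial P :: ('k::field) mpoly) \<in> carrier (poly_ring n)"
  using assms finite_subset[OF assms]
  by (simp add: squarefree_monomial_eq monomial_def poly_ring_def keys_indicator_exponent)

lemma squarefree_monomial_inj:
  assumes "(squarefree_monomial P :: ('k::field) mpoly) = squarefree_monomial P'"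
    "finite P" "finite P'"
  shows "P = P'"
  using assms by (metis squarefree_monomial_eq monomial_eq_iff keys_indicator_exponent)

text \<open>
  For exponents 0 and 1, the first difference is a position that belongs to the greater subword only.
\<close>

lemma lex_greater_squarefree_monomial:
  assumes "finite P" "finite P'"
  shows "lex_greater (squarefree_monomial P :: ('k::field) mpoly) (squarefree_monomial P') \<longleftrightarrow>
    (\<exists>v. v \<in> P \<and> v \<notin> P' \<and> (\<forall>j < v. j \<in> P \<longleftrightarrow> j \<in> P'))"
  using assms
  by (auto simp: lex_greater_def squarefree_monomial_eq monomial_eq_iff lookup_indicator_exponent
      of_bool_def split: if_splits)

lemma lex_greater_squarefree_monomial_asym:
  assumes "finite P" "finite P'"
    and "lex_greater (squarefree_monomial P :: ('k::field) mpoly) (squarefree_monomial P')"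
  shows "\<not> lex_greater (squarefree_monomial P' :: 'k mpoly) (squarefree_monomial P)"
  using assms by (auto simp: lex_greater_squarefree_monomial) (metis linorder_neqE_nat)

text \<open>
  The polynomials all of whose monomials are divisible by some \<open>x\<^sub>P\<close> with \<open>P \<in> R\<close>. This ideal contains
  the generators \<open>x\<^sub>P\<close>, and thus it bounds the ideal that they generate from above.
\<close>

lemma ideal_supported_on:
  "ideal {p \<in> carrier (poly_ring n :: ('k::field) mpoly ring).
     \<forall>a \<in> Poly_Mapping.keys p. \<exists>P \<in> R. P \<subseteq> Poly_Mapping.keys a} (poly_ring n)"
  (is "ideal ?I ?R")
proof -
  interpret cring ?R by (rule cring_poly_ring)
  have keys_add: "Poly_Mapping.keys (a + b) = Poly_Mapping.keys a \<union> Poly_Mapping.keys b"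
    for a b :: "nat \<Rightarrow>\<^sub>0 nat"
    by (auto simp: in_keys_iff lookup_add)
  have mult: "p * q \<in> ?I" if "p \<in> carrier ?R" "q \<in> ?I" for p q
  proof -
    have "p * q \<in> carrier ?R"
      using m_closed[of p q] that by (simp add: poly_ring_def)
    moreover have "\<exists>P \<in> R. P \<subseteq> Poly_Mapping.keys c" if c: "c \<in> Poly_Mapping.keys (p * q)" for c
    proof -
      obtain a b where "c = a + b" "b \<in> Poly_Mapping.keys q"
        using keys_mult[of p q] c by blast
      moreover from this obtain P where "P \<in> R" "P \<subseteq> Poly_Mapping.keys b"
        using \<open>q \<in> ?I\<close> by blast
      ultimately show ?thesis by (auto simp: keys_add)
    qed
    ultimately show ?thesis by blast
  qed
  show ?thesis
  proof (rule idealI)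
    show "ring ?R" by (rule ring_axioms)
    show "subgroup ?I (add_monoid ?R)"
    proof (rule group.subgroupI)
      show "group (add_monoid ?R)" by (rule a_group)
      show "?I \<noteq> {}" by (auto simp: poly_ring_def intro!: exI[of _ 0])
      fix p assume p: "p \<in> ?I"
      have "- p \<in> ?I" using p by (simp add: poly_ring_def)
      moreover have "\<ominus>\<^bsub>?R\<^esub> p = - p"
        by (rule minus_equality) (use p \<open>- p \<in> ?I\<close> in \<open>auto simp: poly_ring_def\<close>)
      ultimately show "inv\<^bsub>add_monoid ?R\<^esub> p \<in> ?I" by (simp add: a_inv_def)
    next
      fix p q assume "p \<in> ?I" "q \<in> ?I"
      then show "p \<otimes>\<^bsub>add_monoid ?R\<^esub> q \<in> ?I"
        using Poly_Mapping.keys_add[of p q] a_closed[of p q]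
        by (auto simp: poly_ring_def)
    qed auto
  next
    fix p q assume pq: "p \<in> ?I" "q \<in> carrier ?R"
    have times: "a \<otimes>\<^bsub>?R\<^esub> b = a * b" for a b by (simp add: poly_ring_def)
    show "q \<otimes>\<^bsub>?R\<^esub> p \<in> ?I"
      unfolding times using pq(2,1) by (rule mult)
    then show "p \<otimes>\<^bsub>?R\<^esub> q \<in> ?I"
      unfolding times mult.commute[of p q] .
  qed
qed

lemma squarefree_monomial_in_genideal:
  assumes "\<forall>P \<in> R. P \<subseteq> {..<n}" "P \<subseteq> {..<n}"
    and "(squarefree_monomial P :: ('k::field) mpoly) \<in> genideal (poly_ring n) (squarefree_monomial ` R)"
  shows "\<exists>P' \<in> R. P' \<subseteq> P"
proof -
  interpret cring "poly_ring n :: 'k mpoly ring" by (rule cring_poly_ring)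
  have fin: "finite P" if "P \<subseteq> {..<n}" for P using that finite_subset by blast
  let ?I = "{p \<in> carrier (poly_ring n :: 'k mpoly ring).
     \<forall>a \<in> Poly_Mapping.keys p. \<exists>P \<in> R. P \<subseteq> Poly_Mapping.keys a}"
  have keys: "Poly_Mapping.keys (squarefree_monomial P :: 'k mpoly) = {indicator_exponent P}"
    "Poly_Mapping.keys (indicator_exponent P) = P" if "P \<subseteq> {..<n}" for P
    using fin[OF that] by (simp_all add: squarefree_monomial_eq monomial_def keys_indicator_exponent)
  have "(squarefree_monomial ` R :: 'k mpoly set) \<subseteq> ?I"
  proof (rule image_subsetI)
    fix P assume "P \<in> R"
    then show "(squarefree_monomial P :: 'k mpoly) \<in> ?I"
      using assms(1) keys[of P] squarefree_monomial_closed[of P n] by auto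
  qed
  then have "genideal (poly_ring n) (squarefree_monomial ` R :: 'k mpoly set) \<subseteq> ?I"
    by (rule genideal_minimal[OF ideal_supported_on])
  then have "(squarefree_monomial P :: 'k mpoly) \<in> ?I"
    using assms(3) by (rule subsetD)
  then show ?thesis
    using assms(2) keys by simp
qed

text \<open>
  Two families generating the same ideal divide each other: each \<open>P \<in> R\<close> contains some \<open>P' \<in> R'\<close>,
  which contains some \<open>P'' \<in> R\<close>. As \<open>R\<close> is an antichain, all three coincide, so \<open>R \<subseteq> R'\<close>;
  equality follows from irredundance of \<open>R'\<close>, as \<open>R\<close> alone generates the ideal.
\<close>

lemma minimal_squarefree_generators:
  fixes R R' :: "nat set set"
  assumes R: "\<forall>P \<in> R. P \<subseteq> {..<n}" and R': "\<forall>P \<in> R'. P \<subseteq> {..<n}"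
    and antichain: "\<And>P P'. P \<in> R \<Longrightarrow> P' \<in> R \<Longrightarrow> P' \<subseteq> P \<Longrightarrow> P' = P"
    and min: "minimal_monomial_generators n (genideal (poly_ring n) (squarefree_monomial ` R))
      (squarefree_monomial ` R' :: ('k::field) mpoly set)"
  shows "R' = R"
proof -
  interpret cring "poly_ring n :: 'k mpoly ring" by (rule cring_poly_ring)
  have fin: "finite P" if "P \<subseteq> {..<n}" for P using that finite_subset by blast
  let ?x = "squarefree_monomial :: nat set \<Rightarrow> 'k mpoly"
  have eq: "genideal (poly_ring n) (?x ` R') = genideal (poly_ring n) (?x ` R)"
    and irredundant: "\<And>G. G \<subset> ?x ` R' \<Longrightarrow> genideal (poly_ring n) G \<noteq> genideal (poly_ring n) (?x ` R)"
    using min by (auto simp: minimal_monomial_generators_def)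
  have mem: "?x P \<in> genideal (poly_ring n) (?x ` A)" if "\<forall>P \<in> A. P \<subseteq> {..<n}" "P \<in> A" for A P
  proof -
    have "?x ` A \<subseteq> carrier (poly_ring n)"
      using that squarefree_monomial_closed by blast
    then show ?thesis using genideal_self that by blast
  qed
  have "R \<subseteq> R'"
  proof
    fix P assume P: "P \<in> R"
    obtain P' where P': "P' \<in> R'" "P' \<subseteq> P"
      using squarefree_monomial_in_genideal[OF R', of P] mem[OF R P] R P eq by metis
    obtain P'' where "P'' \<in> R" "P'' \<subseteq> P'"
      using squarefree_monomial_in_genideal[OF R, of P'] mem[OF R' P'(1)] R' P' eq by metis
    then have "P' = P" using antichain[OF P, of P''] P' by auto
    then show "P \<in> R'" using P' by simp
  qed
  then have "?x ` R = ?x ` R'" using irredundant[of "?x ` R"] by blast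
  moreover have "inj_on ?x R'"
    using R' fin by (intro inj_onI squarefree_monomial_inj[where 'k = 'k]) auto
  ultimately show "R' = R"
    using \<open>R \<subseteq> R'\<close> by (metis inj_on_image_eq_iff subset_refl)
qed

section \<open>The lexicographic shelling\<close>

theorem corollary1p5:
  fixes W :: "('a, 'b) monoid_scheme" and S :: "'a set"
    and Q :: "'a list" and \<pi> :: 'a
    and G :: "('k::field) mpoly set" and Ps :: "nat set list"
  assumes "coxeter_system W S"
    and "Q \<in> lists S"
    and "\<pi> \<in> carrier W"
    and "minimal_monomial_generators (length Q)
           (alexander_dual_ideal (length Q) (subword_complex W S Q \<pi>)) G"
    and "\<forall>P \<in> set Ps. P \<subseteq> {..<length Q}"
    and "G = set (map squarefree_monomial Ps)"
    and "sorted_wrt lex_greater (map squarefree_monomial Ps :: 'k mpoly list)"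
  shows "shelling_order {..<length Q} (subword_complex W S Q \<pi>)
           (map (\<lambda>P. {..<length Q} - P) Ps)"
proof -
  let ?n = "length Q" and ?\<Delta> = "subword_complex W S Q \<pi>"
  let ?x = "squarefree_monomial :: nat set \<Rightarrow> 'k mpoly"
  let ?C = "\<lambda>P. {..<?n} - P"
  define R where "R = {P. P \<subseteq> {..<?n} \<and> represents W S Q P \<pi>}"
  have facets: "facets ?\<Delta> = ?C ` R"
    by (simp add: facets_subword_complex R_def)
  have "(\<lambda>F. ?x (?C F)) ` facets ?\<Delta> = ?x ` R"
    unfolding facets image_image by (intro image_cong) (auto simp: R_def double_diff)
  then have "minimal_monomial_generators ?n (genideal (poly_ring ?n) (?x ` R)) (?x ` set Ps)"
    using assms(4,6) by (simp add: alexander_dual_ideal_def)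
  then have Ps: "set Ps = R"
    using assms(5) represents_subset_eq[of W S Q _ \<pi>]
    by (intro minimal_squarefree_generators[where 'k = 'k and n = ?n]) (auto simp: R_def)
  have fin: "finite P" if "P \<in> R" for P
    using that finite_subset[of P "{..<?n}"] by (auto simp: R_def)
  have inR: "Ps ! i \<in> R" if "i < length Ps" for i
    using Ps nth_mem[OF that] by simp
  have lex: "lex_greater (?x (Ps ! j)) (?x (Ps ! i))" if "j < i" "i < length Ps" for i j
    using assms(7) that by (simp add: sorted_wrt_iff_nth_less)
  \<comment> \<open>The list is sorted by an asymmetric relation, so the order of monomials gives back the indices.\<close>
  have lex_less: "k < i"
    if "i < length Ps" "k < length Ps" "lex_greater (?x (Ps ! k)) (?x (Ps ! i))" for i k
    using that lex[of i k] lex_greater_squarefree_monomial_asym[OF fin fin] inR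
    by (metis linorder_neqE_nat)
  have "distinct Ps"
    unfolding distinct_conv_nth using lex lex_less by (metis linorder_neqE_nat less_irrefl)
  then have "distinct (map ?C Ps)"
    unfolding distinct_map by (auto simp: inj_on_def Ps R_def)
  moreover have "pure_complex ?\<Delta>"
    unfolding pure_complex_def facets
    by (auto simp: R_def card_Diff_subset card_represents finite_subset)
  moreover have "\<exists>v \<in> map ?C Ps ! i - map ?C Ps ! j. \<exists>k < i. map ?C Ps ! i - map ?C Ps ! k = {v}"
    if i: "i < length (map ?C Ps)" and j: "j < i" for i j
  proof -
    have Pi: "Ps ! i \<in> R" and Pj: "Ps ! j \<in> R" using inR i j by auto
    obtain v where v: "v \<in> Ps ! j" "v \<notin> Ps ! i" "\<And>l. l < v \<Longrightarrow> l \<in> Ps ! i \<longleftrightarrow> l \<in> Ps ! j"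
      using lex[OF j] i lex_greater_squarefree_monomial[OF fin[OF Pj] fin[OF Pi], where 'k = 'k]
      by auto
    then have "v < ?n" using Pj by (auto simp: R_def)
    then obtain u where u: "u \<in> Ps ! i" "v < u" "represents W S Q (insert v (Ps ! i) - {u}) \<pi>"
      using represents_exchange[OF assms(1,2), of "Ps ! i" \<pi> "Ps ! j" v] Pi Pj v
      by (auto simp: R_def)
    then have "insert v (Ps ! i) - {u} \<in> R"
      using Pi \<open>v < ?n\<close> by (auto simp: R_def)
    then obtain k where k: "k < length Ps" "Ps ! k = insert v (Ps ! i) - {u}"
      using Ps by (metis in_set_conv_nth)
    have "lex_greater (?x (Ps ! k)) (?x (Ps ! i))"
      unfolding lex_greater_squarefree_monomial[OF fin[OF inR[OF k(1)]] fin[OF Pi]]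
      using u v k by (intro exI[of _ v]) auto
    then have "k < i" using lex_less i k by simp
    moreover have "?C (Ps ! i) - ?C (Ps ! k) = {v}"
      using u v k \<open>v < ?n\<close> by auto
    ultimately show ?thesis
      using v i j k \<open>v < ?n\<close> by (intro bexI[of _ v] exI[of _ k]) auto
  qed
  ultimately show ?thesis
    by (simp add: shelling_order_def simplicial_complex_subword_complex facets Ps)
qed

end
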